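(* Let $(\boldsymbol{X}_i, Y_i)_{i=1}^n$ be i.i.d. observations from the linear model $Y_i = \boldsymbol{X}_i^\top \boldsymbol{\beta}^* + \varepsilon_i$ with $\boldsymbol{\beta}^*\in\mathbb{R}^p$ and $\varepsilon_i \sim U([-a,a])$, $a>0$. Suppose that the design $\boldsymbol{X}_i\in\mathbb{R}^p$ is random and is independent of the noise $\varepsilon_i$. Let $f(p,\gamma)$ be a known function of the dimension $p$ and the scalar $\gamma>0$. Assume that the design is such that for any integer $m\ge f(p,\gamma)$ and an i.i.d. sample $\boldsymbol{X}_1,\dots,\boldsymbol{X}_m$ from the design we have $$\mathbb{P}\big(\xi\,\mathbb{B}_2^p \not\subset \operatorname{conv}(\eta_1\boldsymbol{X}_1,\dots,\eta_m\boldsymbol{X}_m)\big)\le \gamma,$$ for some $\xi>0$, where $\eta_i$ are i.i.d. Rademacher random variables which are also independent from the design. Then, for any estimator $\hat{\boldsymbol{\beta}}$ taking values in the set $$\{\boldsymbol{\beta}\in\mathbb{R}^p : Y_i - a \le \boldsymbol{X}_i^\top\boldsymbol{\beta}\le Y_i + a \ \text{ for all } i\in\{1,\dots,n\}\},$$ we have that for any $L>0$ $$\|\hat{\boldsymbol{\beta}}-\boldsymbol{\beta}^*\| \le \frac{a(L+1)\lceil f(p,\gamma)\rceil}{\xi n}$$ with probability at least $1-\gamma-\exp\Big(\frac{-L^2}{\frac{8}{3}L+2}\Big)$.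
   Context: $\|\cdot\|$ is the Euclidean norm on $\mathbb{R}^p$, $\mathbb{B}_2^p$ is the unit Euclidean ball in $\mathbb{R}^p$ centered at $\mathbf{0}$, and $\operatorname{conv}$ denotes the convex hull. A Rademacher variable takes the values $\pm1$ with probability $1/2$ each. $U([-a,a])$ is the uniform distribution on $[-a,a]$.
   Formalization: The formal theorem adds the assumption n ≥ f(p,γ); without it the claim fails, e.g. for n = 1, p = 2, X uniform on {e1,e2}, where the feasible set is an unbounded strip. *)

theory Defs
  imports "HOL-Probability.Probability"
begin

definition iid_vars :: "'w measure \<Rightarrow> 'b measure \<Rightarrow> ('i \<Rightarrow> 'w \<Rightarrow> 'b) \<Rightarrow> 'i set \<Rightarrow> bool" where
  "iid_vars M N Z I \<longleftrightarrow>
     prob_space.indep_vars M (\<lambda>_. N) Z I \<and>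
     (\<forall>i\<in>I. \<forall>j\<in>I. distr M N (Z i) = distr M N (Z j))"

(* The library's indep_var needs both variables to have the same type; this is independence of the
   generated sigma-algebras. *)
definition indep_pair ::
    "'w measure \<Rightarrow> 'b measure \<Rightarrow> ('w \<Rightarrow> 'b) \<Rightarrow> 'c measure \<Rightarrow> ('w \<Rightarrow> 'c) \<Rightarrow> bool" where
  "indep_pair M N U K V \<longleftrightarrow>
     U \<in> measurable M N \<and> V \<in> measurable M K \<and>
     prob_space.indep_set M (sets (vimage_algebra (space M) U N)) (sets (vimage_algebra (space M) V K))"

definition rademacher :: "real measure" where
  "rademacher = measure_pmf (pmf_of_set {-1, 1})"

(* The law of (X_1, ..., X_m, eta_1, ..., eta_m): an i.i.d. sample from the design distribution D
   together with independent Rademacher signs. *)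
definition signed_sample :: "'v measure \<Rightarrow> nat \<Rightarrow> ((nat \<Rightarrow> 'v) \<times> (nat \<Rightarrow> real)) measure" where
  "signed_sample D m = (\<Pi>\<^sub>M i\<in>{..<m}. D) \<Otimes>\<^sub>M (\<Pi>\<^sub>M i\<in>{..<m}. rademacher)"

(* The event is measurable for D on the Borel sets: for m > 0 the inclusion says that, for every
   unit vector u in a countable dense set, some i < m has u \<bullet> (eta_i X_i) \<ge> xi. *)
definition hull_failure_prob :: "'v::euclidean_space measure \<Rightarrow> nat \<Rightarrow> real \<Rightarrow> real" where
  "hull_failure_prob D m \<xi> =
     measure (signed_sample D m)
       {\<omega> \<in> space (signed_sample D m).
          \<not> (*\<^sub>R) \<xi> ` cball 0 1 \<subseteq> convex hull ((\<lambda>i. snd \<omega> i *\<^sub>R fst \<omega> i) ` {..<m})}"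

definition feasible_set :: "real \<Rightarrow> nat \<Rightarrow> (nat \<Rightarrow> 'v::euclidean_space \<times> real) \<Rightarrow> 'v set" where
  "feasible_set a n d =
     {b. \<forall>i<n. snd (d i) - a \<le> fst (d i) \<bullet> b \<and> fst (d i) \<bullet> b \<le> snd (d i) + a}"

definition sample_data :: "nat \<Rightarrow> (nat \<Rightarrow> 'w \<Rightarrow> 'v) \<Rightarrow> (nat \<Rightarrow> 'w \<Rightarrow> real) \<Rightarrow> 'w \<Rightarrow> nat \<Rightarrow> 'v \<times> real" where
  "sample_data n X Y \<omega> = (\<lambda>i\<in>{..<n}. (X i \<omega>, Y i \<omega>))"

end

theory Submission
  imports Defs
begin

text \<open>
  Write the noise as \<open>\<epsilon>\<^sub>i = - s\<^sub>i r\<^sub>i\<close> with a Rademacher sign \<open>s\<^sub>i\<close> and an independent \<open>r\<^sub>i\<close> uniform on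
  \<open>[0, a]\<close>. A feasible estimate with error \<open>u\<close> satisfies \<open>s\<^sub>i X\<^sub>i \<bullet> u \<le> a - r\<^sub>i\<close> for all \<open>i\<close>. Let
  \<open>m = \<lceil>f(p, \<gamma>)\<rceil>\<close> and \<open>t = a (L + 1) m / n\<close>. Fix the \<open>r\<^sub>i\<close>. If at least \<open>m\<close> of them are \<open>\<ge> a - t\<close>,
  choose \<open>m\<close> such indices; the choice does not depend on the \<open>(X\<^sub>i, s\<^sub>i)\<close>, so with conditional
  probability at least \<open>1 - \<gamma>\<close> the hull of the selected \<open>s\<^sub>i X\<^sub>i\<close> contains the ball of radius \<open>\<xi>\<close>, and
  then \<open>\<xi> \<parallel>u\<parallel> \<le> max s\<^sub>i X\<^sub>i \<bullet> u \<le> t\<close>. The number of indices with \<open>r\<^sub>i \<ge> a - t\<close> is binomial with mean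
  \<open>(L + 1) m\<close> (or all of \<open>n\<close> if \<open>t > a\<close>), and by the Chernoff bound for the lower tail the
  probability that it is below \<open>m\<close> is at most \<open>exp (- m L\<^sup>2 / (2 L + 2)) \<le> exp (- L\<^sup>2 / (8 L / 3 + 2))\<close>.
\<close>

section \<open>Laws of independent pairs and of their finite products\<close>

text \<open>Boxes determine a finite product measure, and on a box both sides factor over the
  coordinates. It is applied twice: with \<open>Pair\<close> as \<open>h\<close>, to zip the designs
  and signs of \<open>signed_sample\<close>, and with the map that builds the noise from a sign and
  a modulus.\<close>

lemma distr_PiM_pair:
  assumes "finite I" and A: "prob_space A" and B: "prob_space B"
    and h[measurable]: "(\<lambda>(x, y). h x y) \<in> measurable (A \<Otimes>\<^sub>M B) C"
  shows "distr (PiM I (\<lambda>_. A) \<Otimes>\<^sub>M PiM I (\<lambda>_. B)) (PiM I (\<lambda>_. C)) (\<lambda>(x, y). \<lambda>i\<in>I. h (x i) (y i)) =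
    PiM I (\<lambda>_. distr (A \<Otimes>\<^sub>M B) C (\<lambda>(x, y). h x y))"
    (is "distr ?P ?C ?H = PiM I (\<lambda>_. ?N)")
proof -
  interpret A: prob_space A by fact
  interpret B: prob_space B by fact
  interpret AB: pair_prob_space A B ..
  interpret PA: product_sigma_finite "\<lambda>_. A" ..
  interpret PB: product_sigma_finite "\<lambda>_. B" ..
  interpret IB: prob_space "PiM I (\<lambda>_. B)" by (intro prob_space_PiM B)
  interpret N: prob_space ?N by (rule AB.prob_space_distr) fact
  interpret PN: product_sigma_finite "\<lambda>_. ?N" ..
  show ?thesis
  proof (rule PN.PiM_eqI)
    show "finite I" by fact
    show "sets (distr ?P ?C ?H) = sets (PiM I (\<lambda>_. ?N))"
      by (simp cong: sets_PiM_cong)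
    fix E :: "'a \<Rightarrow> 'd set"
    assume "\<And>i. i \<in> I \<Longrightarrow> E i \<in> sets ?N"
    then have E[measurable]: "E i \<in> sets C" if "i \<in> I" for i using that by simp
    have hm: "(\<lambda>\<omega>. h (fst \<omega> i) (snd \<omega> i)) \<in> measurable ?P C" if "i \<in> I" for i
    proof -
      have "(\<lambda>\<omega>. (fst \<omega> i, snd \<omega> i)) \<in> measurable ?P (A \<Otimes>\<^sub>M B)" using that by measurable
      from measurable_compose[OF this h] show ?thesis by simp
    qed
    have H[measurable]: "?H \<in> measurable ?P ?C"
      unfolding case_prod_beta by (rule measurable_restrict) (rule hm)
    have PE: "PiE I E \<in> sets ?C" using \<open>finite I\<close> by (intro sets_PiM_I_finite) auto
    have "emeasure (distr ?P ?C ?H) (PiE I E) = (\<integral>\<^sup>+\<omega>. indicator (PiE I E) (?H \<omega>) \<partial>?P)"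
      using PE nn_integral_distr[OF H, of "indicator (PiE I E)"] by simp
    also have "\<dots> = (\<integral>\<^sup>+\<omega>. (\<Prod>i\<in>I. indicator (E i) (h (fst \<omega> i) (snd \<omega> i))) \<partial>?P)"
    proof (rule nn_integral_cong)
      fix \<omega>
      show "indicator (PiE I E) (?H \<omega>) = (\<Prod>i\<in>I. indicator (E i) (h (fst \<omega> i) (snd \<omega> i)) :: ennreal)"
        using \<open>finite I\<close> by (auto simp: case_prod_beta indicator_def PiE_iff split: if_splits)
    qed
    \<comment> \<open>After Tonelli the product over \<open>I\<close> is pulled out twice: first for
      fixed \<open>x\<close> from the integral over all \<open>y i\<close>, then from the integral
      over all \<open>x i\<close>.\<close>
    also have "\<dots> = (\<integral>\<^sup>+x. \<integral>\<^sup>+y. (\<Prod>i\<in>I. indicator (E i) (h (x i) (y i))) \<partial>PiM I (\<lambda>_. B) \<partial>PiM I (\<lambda>_. A))"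
    proof (subst IB.nn_integral_fst[symmetric])
      show "(\<lambda>\<omega>. \<Prod>i\<in>I. indicator (E i) (h (fst \<omega> i) (snd \<omega> i)) :: ennreal) \<in> borel_measurable ?P"
      proof (rule borel_measurable_prod_ennreal)
        fix i assume "i \<in> I"
        then show "(\<lambda>\<omega>. indicator (E i) (h (fst \<omega> i) (snd \<omega> i)) :: ennreal) \<in> borel_measurable ?P"
          by (intro measurable_compose[OF hm]) auto
      qed
    qed simp
    also have "\<dots> = (\<integral>\<^sup>+x. (\<Prod>i\<in>I. \<integral>\<^sup>+y. indicator (E i) (h (x i) y) \<partial>B) \<partial>PiM I (\<lambda>_. A))"
    proof (rule nn_integral_cong)
      fix x assume x: "x \<in> space (PiM I (\<lambda>_. A))"
      show "(\<integral>\<^sup>+y. (\<Prod>i\<in>I. indicator (E i) (h (x i) (y i))) \<partial>PiM I (\<lambda>_. B)) =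
          (\<Prod>i\<in>I. \<integral>\<^sup>+y. indicator (E i) (h (x i) y) \<partial>B)"
      proof (rule PB.product_nn_integral_prod[OF \<open>finite I\<close>])
        fix i assume i: "i \<in> I"
        then have "x i \<in> space A" using x by (auto simp: space_PiM)
        then have "(\<lambda>y. (x i, y)) \<in> measurable B (A \<Otimes>\<^sub>M B)" by simp
        from measurable_compose[OF this h]
        have [measurable]: "h (x i) \<in> measurable B C" by simp
        show "(\<lambda>y. indicator (E i) (h (x i) y) :: ennreal) \<in> borel_measurable B"
          using i by measurable
      qed
    qed
    also have "\<dots> = (\<Prod>i\<in>I. \<integral>\<^sup>+x. \<integral>\<^sup>+y. indicator (E i) (h x y) \<partial>B \<partial>A)"
    proof (rule PA.product_nn_integral_prod[OF \<open>finite I\<close>])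
      fix i assume "i \<in> I"
      then show "(\<lambda>x. \<integral>\<^sup>+y. indicator (E i) (h x y) \<partial>B) \<in> borel_measurable A"
        by measurable
    qed
    also have "\<dots> = (\<Prod>i\<in>I. emeasure ?N (E i))"
    proof (rule prod.cong[OF refl])
      fix i assume i: "i \<in> I"
      have "emeasure ?N (E i) = (\<integral>\<^sup>+z. indicator (E i) ((\<lambda>(x, y). h x y) z) \<partial>(A \<Otimes>\<^sub>M B))"
        using E[OF i] nn_integral_distr[OF h, of "indicator (E i)"] by simp
      also have "\<dots> = (\<integral>\<^sup>+x. \<integral>\<^sup>+y. indicator (E i) (h x y) \<partial>B \<partial>A)"
        using i by (subst B.nn_integral_fst[symmetric]) (auto simp: case_prod_beta)
      finally show "(\<integral>\<^sup>+x. \<integral>\<^sup>+y. indicator (E i) (h x y) \<partial>B \<partial>A) = emeasure ?N (E i)" ..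
    qed
    finally show "emeasure (distr ?P ?C ?H) (PiE I E) = (\<Prod>i\<in>I. emeasure ?N (E i))" .
  qed
qed

text \<open>Rectangles suffice, and on them independence of the generated sigma-algebras is exactly
  the product formula.\<close>

lemma distr_pair_of_indep_pair:
  assumes "prob_space M" and ind: "indep_pair M N U K V"
  shows "distr M (N \<Otimes>\<^sub>M K) (\<lambda>\<omega>. (U \<omega>, V \<omega>)) = distr M N U \<Otimes>\<^sub>M distr M K V"
proof -
  interpret prob_space M by fact
  have [measurable]: "U \<in> measurable M N" "V \<in> measurable M K"
    and I: "indep_set (sets (vimage_algebra (space M) U N)) (sets (vimage_algebra (space M) V K))"
    using ind by (auto simp: indep_pair_def)
  interpret U: prob_space "distr M N U" by (rule prob_space_distr) simp
  interpret V: prob_space "distr M K V" by (rule prob_space_distr) simp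
  have "distr M N U \<Otimes>\<^sub>M distr M K V = distr M (N \<Otimes>\<^sub>M K) (\<lambda>\<omega>. (U \<omega>, V \<omega>))"
  proof (rule pair_measure_eqI)
    show "sigma_finite_measure (distr M N U)" "sigma_finite_measure (distr M K V)" ..
    show "sets (distr M N U \<Otimes>\<^sub>M distr M K V) = sets (distr M (N \<Otimes>\<^sub>M K) (\<lambda>\<omega>. (U \<omega>, V \<omega>)))"
      by (simp cong: sets_pair_measure_cong)
    fix A B assume "A \<in> sets (distr M N U)" "B \<in> sets (distr M K V)"
    then have [measurable]: "A \<in> sets N" "B \<in> sets K" by auto
    have "prob ((U -` A \<inter> space M) \<inter> (V -` B \<inter> space M)) =
        prob (U -` A \<inter> space M) * prob (V -` B \<inter> space M)"
      by (rule indep_setD[OF I]) (auto intro!: in_vimage_algebra)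
    moreover have "(U -` A \<inter> space M) \<inter> (V -` B \<inter> space M) =
        (\<lambda>\<omega>. (U \<omega>, V \<omega>)) -` (A \<times> B) \<inter> space M" by auto
    ultimately show "emeasure (distr M N U) A * emeasure (distr M K V) B =
        emeasure (distr M (N \<Otimes>\<^sub>M K) (\<lambda>\<omega>. (U \<omega>, V \<omega>))) (A \<times> B)"
      by (simp add: emeasure_distr emeasure_eq_measure ennreal_mult)
  qed
  then show ?thesis ..
qed

section \<open>Chernoff bound for the lower tail of a count\<close>

text \<open>The difference of the two sides vanishes at 0 and has derivative y - 1 + exp (- y),
  which is nonnegative by the tangent inequality. In the Chernoff bound it makes the exponent
  quadratic in \<open>l\<close>, so that the best \<open>l\<close> has a closed form.\<close>

lemma exp_minus_le_quadratic:
  fixes x :: real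
  assumes "x \<ge> 0"
  shows "exp (- x) \<le> 1 - x + x\<^sup>2 / 2"
proof -
  have "(\<lambda>x::real. 1 - x + x\<^sup>2 / 2 - exp (- x)) 0 \<le> (\<lambda>x. 1 - x + x\<^sup>2 / 2 - exp (- x)) x"
  proof (rule DERIV_nonneg_imp_nondecreasing[OF assms])
    fix y :: real
    have "((\<lambda>x. 1 - x + x\<^sup>2 / 2 - exp (- x)) has_real_derivative (- 1 + y + exp (- y))) (at y)"
      by (auto intro!: derivative_eq_intros)
    moreover have "0 \<le> - 1 + y + exp (- y)" using exp_ge_add_one_self[of "- y"] by simp
    ultimately show "\<exists>d. ((\<lambda>x. 1 - x + x\<^sup>2 / 2 - exp (- x)) has_real_derivative d) (at y) \<and> 0 \<le> d"
      by blast
  qed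
  then show ?thesis by simp
qed

lemma sets_hits_less:
  assumes "finite I" and A[measurable]: "A \<in> sets V"
  shows "{r \<in> space (PiM I (\<lambda>_. V)). card {i \<in> I. r i \<in> A} < m} \<in> sets (PiM I (\<lambda>_. V))"
proof -
  have "real (card {i \<in> I. r i \<in> A}) = (\<Sum>i\<in>I. indicator A (r i))" for r
    using \<open>finite I\<close> by (simp add: indicator_def sum.If_cases Int_def)
  then have "{r \<in> space (PiM I (\<lambda>_. V)). card {i \<in> I. r i \<in> A} < m} =
      {r \<in> space (PiM I (\<lambda>_. V)). (\<Sum>i\<in>I. indicator A (r i)) < real m}"
    unfolding of_nat_less_iff[where 'a=real, symmetric] by simp
  also have "\<dots> \<in> sets (PiM I (\<lambda>_. V))"
    by measurable
  finally show ?thesis .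
qed

text \<open>Exponential Markov inequality: with N the number of hits and l \<ge> 0, the weight exp
  (l (m - N)) is at least 1 where N < m, and its integral factors over the independent
  coordinates.\<close>

lemma hits_lower_tail:
  fixes I :: "'i set" and V :: "'v measure" and m :: nat and \<mu> :: real
  assumes V: "prob_space V" and "finite I" and A[measurable]: "A \<in> sets V"
    and \<mu>: "\<mu> = card I * measure V A" and m: "real m \<le> \<mu>" "\<mu> > 0"
  shows "measure (PiM I (\<lambda>_. V)) {r \<in> space (PiM I (\<lambda>_. V)). card {i \<in> I. r i \<in> A} < m}
    \<le> exp (- (\<mu> - m)\<^sup>2 / (2 * \<mu>))"
proof -
  interpret V: prob_space V by fact
  interpret PV: product_sigma_finite "\<lambda>_. V" ..
  interpret P: prob_space "PiM I (\<lambda>_. V)" by (intro prob_space_PiM V)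
  let ?P = "PiM I (\<lambda>_. V)"
  let ?bad = "{r \<in> space ?P. card {i \<in> I. r i \<in> A} < m}"
  \<comment> \<open>The minimiser of the exponent \<open>l m - \<mu> (l - l\<^sup>2 / 2)\<close> of the Chernoff bound.\<close>
  define l where "l = 1 - m / \<mu>"
  define q where "q = V.prob A"
  have l: "l \<ge> 0" using m by (simp add: l_def)
  \<comment> \<open>The factor that one coordinate contributes to exp (- l N). It takes values in
    \<open>ennreal\<close> so that the product formula for nonnegative integrals applies.\<close>
  define c where "c = (\<lambda>x. ennreal (if x \<in> A then exp (- l) else 1))"
  have [measurable]: "c \<in> borel_measurable V" unfolding c_def by measurable
  have int_c: "(\<integral>\<^sup>+x. c x \<partial>V) = ennreal (1 - q * (1 - exp (- l)))"
  proof -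
    have "(\<integral>\<^sup>+x. c x \<partial>V) = (\<integral>\<^sup>+x. ennreal (exp (- l)) * indicator A x + indicator (space V - A) x \<partial>V)"
      by (intro nn_integral_cong) (auto simp: c_def indicator_def)
    also have "\<dots> = ennreal (exp (- l)) * emeasure V A + emeasure V (space V - A)"
      by (simp add: nn_integral_add nn_integral_cmult)
    also have "\<dots> = ennreal (exp (- l) * q + (1 - q))"
      by (simp add: V.emeasure_eq_measure V.prob_compl q_def ennreal_mult ennreal_plus)
    finally show ?thesis by (simp add: algebra_simps)
  qed
  have q: "0 \<le> q" "q \<le> 1" by (auto simp: q_def)
  have e1: "0 \<le> 1 - exp (- l)" "1 - exp (- l) \<le> 1" using l by auto
  have q1: "0 \<le> 1 - q * (1 - exp (- l))" using q e1 mult_mono[of q 1 "1 - exp (- l)" 1] by simp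
  have card_if: "(\<Prod>i\<in>I. c (r i)) = ennreal (exp (- l * card {i \<in> I. r i \<in> A}))" for r
  proof -
    have "(\<Prod>i\<in>I. c (r i)) = ennreal (\<Prod>i\<in>I. if r i \<in> A then exp (- l) else 1)"
      unfolding c_def by (rule prod_ennreal) auto
    also have "(\<Prod>i\<in>I. if r i \<in> A then exp (- l) else 1) = (\<Prod>i\<in>{i \<in> I. r i \<in> A}. exp (- l))"
      using \<open>finite I\<close> by (simp add: prod.If_cases Int_def)
    also have "\<dots> = exp (- l * card {i \<in> I. r i \<in> A})"
      by (simp add: exp_of_nat_mult[symmetric] mult.commute)
    finally show ?thesis .
  qed
  have "emeasure ?P ?bad \<le> (\<integral>\<^sup>+r. ennreal (exp (l * m)) * (\<Prod>i\<in>I. c (r i)) \<partial>?P)"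
  proof -
    have "emeasure ?P ?bad = (\<integral>\<^sup>+r. indicator ?bad r \<partial>?P)" using sets_hits_less[OF \<open>finite I\<close> A] by simp
    also have "\<dots> \<le> (\<integral>\<^sup>+r. ennreal (exp (l * m)) * (\<Prod>i\<in>I. c (r i)) \<partial>?P)"
    proof (rule nn_integral_mono)
      fix r assume "r \<in> space ?P"
      show "indicator ?bad r \<le> ennreal (exp (l * m)) * (\<Prod>i\<in>I. c (r i))"
      proof (cases "card {i \<in> I. r i \<in> A} < m")
        case True
        have "0 \<le> l * m - l * card {i \<in> I. r i \<in> A}"
          using True l by (simp add: mult_left_mono)
        then have "1 \<le> exp (l * m) * exp (- l * card {i \<in> I. r i \<in> A})"
          by (simp add: exp_add[symmetric])
        then have "1 \<le> ennreal (exp (l * m) * exp (- l * card {i \<in> I. r i \<in> A}))"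
          by simp
        then have "1 \<le> ennreal (exp (l * m)) * (\<Prod>i\<in>I. c (r i))"
          unfolding card_if by (subst ennreal_mult[symmetric]) auto
        then show ?thesis by (auto simp: indicator_def)
      qed (auto simp: indicator_def)
    qed
    finally show ?thesis .
  qed
  also have "\<dots> = ennreal (exp (l * m)) * (\<Prod>i\<in>I. \<integral>\<^sup>+x. c x \<partial>V)"
    using \<open>finite I\<close>
    by (subst nn_integral_cmult) (auto simp: PV.product_nn_integral_prod[of I "\<lambda>_. c"])
  also have "\<dots> = ennreal (exp (l * m) * (1 - q * (1 - exp (- l))) ^ card I)"
    using q1 by (simp add: int_c ennreal_power ennreal_mult)
  finally have "P.prob ?bad \<le> exp (l * m) * (1 - q * (1 - exp (- l))) ^ card I"
    using q1 by (simp add: P.emeasure_eq_measure)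
  \<comment> \<open>Per coordinate, 1 - exp (- l) \<ge> l - l^2 / 2, and then 1 + x \<le> exp x
    turns the power into a single exponential.\<close>
  also have "\<dots> \<le> exp (l * m) * exp (- q * (l - l\<^sup>2 / 2)) ^ card I"
  proof (intro mult_left_mono power_mono)
    have "1 - q * (1 - exp (- l)) \<le> 1 + (- q * (l - l\<^sup>2 / 2))"
      using mult_left_mono[OF exp_minus_le_quadratic[OF l] q(1)] by (simp add: algebra_simps)
    also have "\<dots> \<le> exp (- q * (l - l\<^sup>2 / 2))" by (rule exp_ge_add_one_self)
    finally show "1 - q * (1 - exp (- l)) \<le> exp (- q * (l - l\<^sup>2 / 2))" .
  qed (use q1 in auto)
  also have "\<dots> = exp (l * m - \<mu> * (l - l\<^sup>2 / 2))"
    unfolding exp_of_nat_mult[symmetric] exp_add[symmetric] \<mu> q_def by (simp add: algebra_simps)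
  \<comment> \<open>Since l = (\<mu> - m) / \<mu>, the exponent is - l (\<mu> - m) + \<mu> l^2 / 2,
    and the second term cancels half of the first.\<close>
  also have "l * m - \<mu> * (l - l\<^sup>2 / 2) = - (\<mu> - m)\<^sup>2 / (2 * \<mu>)"
    using m by (simp add: l_def field_simps power2_eq_square)
  finally show ?thesis .
qed

section \<open>Balls inside convex hulls, in terms of support functions\<close>

text \<open>Compact convex sets are ordered by inclusion as their support functions are, and \<xi>
  times the norm is the support function of the ball. One direction tests the ball at its extreme
  point in direction \<open>u\<close>, the other separates a missing point from
  \<open>K\<close>.\<close>

lemma scaled_cball_subset_iff:
  fixes K :: "'v::euclidean_space set"
  assumes "compact K" "convex K" "K \<noteq> {}" "\<xi> > 0"
  shows "(*\<^sub>R) \<xi> ` cball 0 1 \<subseteq> K \<longleftrightarrow> (\<forall>u. \<exists>k\<in>K. \<xi> * norm u \<le> u \<bullet> k)"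
proof
  assume sub: "(*\<^sub>R) \<xi> ` cball 0 1 \<subseteq> K"
  show "\<forall>u. \<exists>k\<in>K. \<xi> * norm u \<le> u \<bullet> k"
  proof
    fix u :: 'v
    have "\<xi> *\<^sub>R sgn u \<in> (*\<^sub>R) \<xi> ` cball 0 1"
      by (rule imageI) (auto simp: norm_sgn)
    then have "\<xi> *\<^sub>R sgn u \<in> K" using sub by blast
    moreover have "u \<bullet> (\<xi> *\<^sub>R sgn u) = \<xi> * norm u"
      by (cases "u = 0") (auto simp: sgn_div_norm dot_square_norm power2_eq_square)
    ultimately show "\<exists>k\<in>K. \<xi> * norm u \<le> u \<bullet> k" by (metis order_refl)
  qed
next
  assume *: "\<forall>u. \<exists>k\<in>K. \<xi> * norm u \<le> u \<bullet> k"
  show "(*\<^sub>R) \<xi> ` cball 0 1 \<subseteq> K"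
  proof
    fix z :: 'v assume "z \<in> (*\<^sub>R) \<xi> ` cball 0 1"
    then obtain y where z: "z = \<xi> *\<^sub>R y" and y: "norm y \<le> 1" by fastforce
    show "z \<in> K"
    proof (rule ccontr)
      assume "z \<notin> K"
      then obtain u b where u: "u \<bullet> z < b" "\<forall>x\<in>K. u \<bullet> x > b"
        using separating_hyperplane_closed_point[of K z] assms compact_imp_closed by blast
      \<comment> \<open>The separating hyperplane leaves \<open>K\<close> on its upper side, so the
        assumption is used in the direction - u.\<close>
      obtain k where k: "k \<in> K" "\<xi> * norm (- u) \<le> (- u) \<bullet> k" using * by blast
      have "- (u \<bullet> y) \<le> norm u * norm y" using norm_cauchy_schwarz[of "- u" y] by simp
      also have "\<dots> \<le> norm u" using y by (simp add: mult_left_le)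
      finally have "- (u \<bullet> z) \<le> \<xi> * norm u" using \<open>\<xi> > 0\<close> mult_left_mono[of "- (u \<bullet> y)" "norm u" \<xi>] by (simp add: z)
      with k u show False by fastforce
    qed
  qed
qed

text \<open>If every generator lies in an open half-space, so does the hull; hence only generators
  need testing. This reduces the geometric event to finitely many inner products per
  direction.\<close>

lemma scaled_cball_subset_hull_iff:
  fixes x :: "nat \<Rightarrow> 'v::euclidean_space"
  assumes "S \<noteq> {}" "finite S" "\<xi> > 0"
  shows "(*\<^sub>R) \<xi> ` cball 0 1 \<subseteq> convex hull (x ` S) \<longleftrightarrow>
    (\<forall>u. \<exists>i\<in>S. \<xi> * norm u \<le> u \<bullet> x i)"
proof -
  have "(\<exists>k\<in>convex hull (x ` S). c \<le> u \<bullet> k) \<longleftrightarrow> (\<exists>i\<in>S. c \<le> u \<bullet> x i)" for c u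
  proof
    assume "\<exists>k\<in>convex hull (x ` S). c \<le> u \<bullet> k"
    then obtain k where k: "k \<in> convex hull (x ` S)" "c \<le> u \<bullet> k" by blast
    show "\<exists>i\<in>S. c \<le> u \<bullet> x i"
    proof (rule ccontr)
      assume "\<not> (\<exists>i\<in>S. c \<le> u \<bullet> x i)"
      then have "convex hull (x ` S) \<subseteq> {y. u \<bullet> y < c}"
        by (intro hull_minimal) (auto simp: convex_halfspace_lt)
      then show False using k by auto
    qed
  qed (auto intro: hull_inc)
  then show ?thesis
    using scaled_cball_subset_iff[of "convex hull (x ` S)" \<xi>] assms
    by (simp add: finite_imp_compact_convex_hull)
qed

section \<open>Rademacher signs and the splitting of the uniform noise into sign and modulus\<close>

lemma prob_space_rademacher: "prob_space rademacher"
  unfolding rademacher_def by (rule prob_space_measure_pmf)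

text \<open>\<open>rademacher\<close> carries the power set as its sigma-algebra, so a sign is
  turned into a Borel variable through this map.\<close>

lemma ident_measurable_rademacher: "(\<lambda>s. s) \<in> borel_measurable rademacher"
  unfolding rademacher_def by simp

lemma AE_rademacher: "AE s in rademacher. \<bar>s\<bar> = 1"
  unfolding rademacher_def by (simp add: AE_measure_pmf_iff)

lemma nn_integral_rademacher:
  "(\<integral>\<^sup>+s. g s \<partial>rademacher) = (g 1 + g (-1)) / 2"
  unfolding rademacher_def by (simp add: nn_integral_pmf_of_set add.commute)

lemma emeasure_lborel_symmetric_interval:
  fixes B :: "real set"
  assumes B[measurable]: "B \<in> sets borel" and "a \<ge> 0"
  shows "emeasure lborel ({-a..a} \<inter> B) =
    emeasure lborel ({0..a} \<inter> B) + emeasure lborel ({0..a} \<inter> uminus -` B)"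
proof -
  have "emeasure lborel ({0..a} \<inter> uminus -` B) = emeasure (distr lborel borel uminus) ({-a..0} \<inter> B)"
    by (subst emeasure_distr) (auto intro!: arg_cong[where f="emeasure lborel"])
  also have "\<dots> = emeasure lborel ({-a..0} \<inter> B)" by (simp add: lborel_distr_uminus)
  \<comment> \<open>The point 0 belongs to both halves; it is a null set and is dropped from one of
    them to make the union disjoint.\<close>
  also have "\<dots> = emeasure lborel ({-a..<0} \<inter> B)"
    by (rule emeasure_eq_AE) (use AE_lborel_singleton[of 0] in \<open>auto elim: eventually_mono\<close>)
  finally have "emeasure lborel ({0..a} \<inter> B) + emeasure lborel ({0..a} \<inter> uminus -` B) =
      emeasure lborel (({0..a} \<inter> B) \<union> ({-a..<0} \<inter> B))"
    by (subst plus_emeasure[symmetric]) auto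
  also have "({0..a} \<inter> B) \<union> ({-a..<0} \<inter> B) = {-a..a} \<inter> B" using \<open>a \<ge> 0\<close> by auto
  finally show ?thesis ..
qed

lemma measurable_signed_noise:
  fixes D :: "'v::euclidean_space measure"
  assumes [measurable_cong]: "sets D = sets borel" "sets V = sets borel"
  shows "(\<lambda>(w, r). (fst w, - snd w * r)) \<in> measurable ((D \<Otimes>\<^sub>M rademacher) \<Otimes>\<^sub>M V) borel"
proof -
  have [measurable]: "(\<lambda>z. snd (fst z)) \<in> borel_measurable ((D \<Otimes>\<^sub>M rademacher) \<Otimes>\<^sub>M V)"
    by (rule measurable_compose[OF _ ident_measurable_rademacher]) measurable
  show ?thesis
    unfolding borel_prod[symmetric] case_prod_beta by measurable
qed

lemma measurable_signed_component:
  fixes D :: "'v::euclidean_space measure"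
  assumes [measurable_cong]: "sets D = sets borel" and "i \<in> I"
  shows "(\<lambda>w. snd (w i) *\<^sub>R fst (w i)) \<in> borel_measurable (PiM I (\<lambda>_. D \<Otimes>\<^sub>M rademacher))"
proof -
  have [measurable]: "snd \<in> borel_measurable (D \<Otimes>\<^sub>M rademacher)"
    by (rule measurable_compose[OF _ ident_measurable_rademacher]) measurable
  have "(\<lambda>w. snd w *\<^sub>R fst w) \<in> borel_measurable (D \<Otimes>\<^sub>M rademacher)" by measurable
  from measurable_compose[OF measurable_component_singleton[OF \<open>i \<in> I\<close>, of "\<lambda>_. D \<Otimes>\<^sub>M rademacher"] this]
  show ?thesis .
qed

text \<open>On a rectangle the design factor comes out, and averaging over the sign leaves the mean
  of the masses that the uniform law on [0, a] gives to \<open>B\<close> and to its reflection. That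
  mean is the mass of \<open>B\<close> under the uniform law on [-a, a]. This lets the sign be made
  explicit while the joint law of design and noise is unchanged.\<close>

lemma distr_signed_uniform:
  fixes D :: "'v::euclidean_space measure"
  assumes D: "prob_space D" and sets_D[measurable_cong]: "sets D = sets borel" and "a > 0"
  shows "distr ((D \<Otimes>\<^sub>M rademacher) \<Otimes>\<^sub>M uniform_measure lborel {0..a}) borel
      (\<lambda>(w, r). (fst w, - snd w * r)) = D \<Otimes>\<^sub>M uniform_measure lborel {-a..a}"
    (is "distr (?W \<Otimes>\<^sub>M ?V) borel ?T = D \<Otimes>\<^sub>M ?U")
proof -
  interpret D: prob_space D by fact
  interpret R: prob_space rademacher by (rule prob_space_rademacher)
  interpret V: prob_space ?V using \<open>a > 0\<close> by (intro prob_space_uniform_measure) auto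
  interpret U: prob_space ?U using \<open>a > 0\<close> by (intro prob_space_uniform_measure) auto
  have [measurable]: "snd \<in> borel_measurable ?W"
    by (rule measurable_compose[OF _ ident_measurable_rademacher]) measurable
  have [measurable]: "(\<lambda>z. snd (fst z)) \<in> borel_measurable (?W \<Otimes>\<^sub>M ?V)"
    by measurable
  have T: "?T \<in> measurable (?W \<Otimes>\<^sub>M ?V) borel"
    by (rule measurable_signed_noise) (simp_all add: sets_D)
  have "D \<Otimes>\<^sub>M ?U = distr (?W \<Otimes>\<^sub>M ?V) borel ?T"
  proof (rule pair_measure_eqI)
    show "sigma_finite_measure D" "sigma_finite_measure ?U" ..
    show "sets (D \<Otimes>\<^sub>M ?U) = sets (distr (?W \<Otimes>\<^sub>M ?V) borel ?T)"
      using sets_D by (simp add: borel_prod[symmetric] cong: sets_pair_measure_cong)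
    fix A B assume "A \<in> sets D" "B \<in> sets ?U"
    then have A: "A \<in> sets borel" "A \<in> sets D" and B: "B \<in> sets borel" using sets_D by auto
    note [measurable] = A B
    have nB[measurable]: "uminus -` B \<in> sets borel"
      using measurable_sets[of uminus borel borel B] B by simp
    have AB: "A \<times> B \<in> sets borel" unfolding borel_prod[symmetric] using A B by auto
    have "emeasure (distr (?W \<Otimes>\<^sub>M ?V) borel ?T) (A \<times> B) =
        (\<integral>\<^sup>+z. indicator (A \<times> B) (?T z) \<partial>(?W \<Otimes>\<^sub>M ?V))"
      using AB nn_integral_distr[OF T, of "indicator (A \<times> B)"] by simp
    also have "\<dots> = (\<integral>\<^sup>+z. indicator A (fst (fst z)) * indicator B (- snd (fst z) * snd z) \<partial>(?W \<Otimes>\<^sub>M ?V))"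
      by (intro nn_integral_cong) (auto simp: indicator_def)
    also have "\<dots> = (\<integral>\<^sup>+w. \<integral>\<^sup>+r. indicator A (fst w) * indicator B (- snd w * r) \<partial>?V \<partial>?W)"
      by (subst V.nn_integral_fst[symmetric]) auto
    also have "\<dots> = (\<integral>\<^sup>+x. \<integral>\<^sup>+s. \<integral>\<^sup>+r. indicator A x * indicator B (- s * r) \<partial>?V \<partial>rademacher \<partial>D)"
      by (subst R.nn_integral_fst[symmetric]) auto
    also have "\<dots> = (\<integral>\<^sup>+x. indicator A x * (\<integral>\<^sup>+s. \<integral>\<^sup>+r. indicator B (- s * r) \<partial>?V \<partial>rademacher) \<partial>D)"
    proof (rule nn_integral_cong)
      fix x
      have "(\<integral>\<^sup>+r. indicator A x * indicator B (- s * r) \<partial>?V) =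
          indicator A x * (\<integral>\<^sup>+r. indicator B (- s * r) \<partial>?V)" for s
        by (rule nn_integral_cmult) measurable
      then show "(\<integral>\<^sup>+s. \<integral>\<^sup>+r. indicator A x * indicator B (- s * r) \<partial>?V \<partial>rademacher) =
          indicator A x * (\<integral>\<^sup>+s. \<integral>\<^sup>+r. indicator B (- s * r) \<partial>?V \<partial>rademacher)"
        by (simp add: nn_integral_cmult rademacher_def)
    qed
    also have "\<dots> = emeasure D A * (\<integral>\<^sup>+s. \<integral>\<^sup>+r. indicator B (- s * r) \<partial>?V \<partial>rademacher)"
      by (simp add: nn_integral_multc)
    also have "(\<integral>\<^sup>+s. \<integral>\<^sup>+r. indicator B (- s * r) \<partial>?V \<partial>rademacher) =
        (emeasure ?V (uminus -` B) + emeasure ?V B) / 2"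
    proof -
      have "(\<integral>\<^sup>+r. indicator B (- r) \<partial>?V) = (\<integral>\<^sup>+r. indicator (uminus -` B) r \<partial>?V)"
        by (intro nn_integral_cong) (auto simp: indicator_def)
      then show ?thesis by (simp add: nn_integral_rademacher)
    qed
    also have "\<dots> = emeasure ?U B"
    proof -
      \<comment> \<open>The factor 1/2 from the sign turns the normalisation 1 / a of the modulus
        into the normalisation 1 / (2 a) of the noise.\<close>
      have half: "inverse (ennreal (2 * a)) = inverse (ennreal a) * inverse 2"
        using \<open>a > 0\<close>
        by (simp add: ennreal_mult ennreal_inverse_mult mult.commute)
      show ?thesis
        using \<open>a > 0\<close> emeasure_lborel_symmetric_interval[OF B, of a]
        by (simp add: divide_ennreal_def half) (simp add: algebra_simps)
    qed
    finally show "emeasure D A * emeasure ?U B = emeasure (distr (?W \<Otimes>\<^sub>M ?V) borel ?T) (A \<times> B)" ..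
  qed
  then show ?thesis ..
qed

section \<open>The hull event for a subsample\<close>

text \<open>For fixed vectors, the directions in which the inequality holds for some index form a
  finite union of closed sets. If that union contains a countable dense set, it is the whole space,
  so countably many directions decide the event.\<close>

lemma sets_support_failure:
  fixes x :: "'a \<Rightarrow> 'i \<Rightarrow> 'v::euclidean_space"
  assumes "finite S" and [measurable]: "\<And>i. i \<in> S \<Longrightarrow> (\<lambda>\<omega>. x \<omega> i) \<in> borel_measurable N"
  shows "{\<omega> \<in> space N. \<not> (\<forall>u. \<exists>i\<in>S. \<xi> * norm u \<le> u \<bullet> x \<omega> i)} \<in> sets N"
proof -
  obtain Q :: "'v set" where Q: "countable Q" "UNIV \<subseteq> closure Q"
    using separable[of "UNIV :: 'v set"] by metis
  have dense: "(\<forall>u. \<exists>i\<in>S. \<xi> * norm u \<le> u \<bullet> y i) \<longleftrightarrow> (\<forall>u\<in>Q. \<exists>i\<in>S. \<xi> * norm u \<le> u \<bullet> y i)"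
    for y :: "'i \<Rightarrow> 'v"
  proof
    assume *: "\<forall>u\<in>Q. \<exists>i\<in>S. \<xi> * norm u \<le> u \<bullet> y i"
    have "closed (\<Union>i\<in>S. {u. \<xi> * norm u \<le> u \<bullet> y i})"
      using \<open>finite S\<close> by (intro closed_UN ballI closed_Collect_le continuous_intros) auto
    then have "closure Q \<subseteq> (\<Union>i\<in>S. {u. \<xi> * norm u \<le> u \<bullet> y i})"
      using * by (intro closure_minimal) auto
    then show "\<forall>u. \<exists>i\<in>S. \<xi> * norm u \<le> u \<bullet> y i" using Q by blast
  qed auto
  show ?thesis unfolding dense
    by (intro sets.sets_Collect_neg sets.sets_Collect_countable_All' sets.sets_Collect_finite_Ex
        Q(1) \<open>finite S\<close>)
       measurable
qed

text \<open>Any m coordinates of an i.i.d. family have the law of a fresh sample of size m, so the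
  assumption on the design applies to every index set chosen without looking at the pairs
  \<open>w i\<close>.\<close>

lemma hull_failure_prob_subsample:
  fixes D :: "'v::euclidean_space measure" and S :: "'i set"
  assumes D: "prob_space D" and sets_D[measurable_cong]: "sets D = sets borel"
    and S: "finite S" "S \<subseteq> I" "card S = m" and "m > 0" "\<xi> > 0"
  shows "measure (PiM I (\<lambda>_. D \<Otimes>\<^sub>M rademacher))
      {w \<in> space (PiM I (\<lambda>_. D \<Otimes>\<^sub>M rademacher)).
        \<not> (\<forall>u. \<exists>i\<in>S. \<xi> * norm u \<le> u \<bullet> (snd (w i) *\<^sub>R fst (w i)))} = hull_failure_prob D m \<xi>"
proof -
  let ?W = "D \<Otimes>\<^sub>M rademacher"
  let ?K = "{..<m}"
  let ?ok = "\<lambda>S w. \<forall>u. \<exists>i\<in>S. \<xi> * norm u \<le> u \<bullet> (snd (w i) *\<^sub>R fst (w i))"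
  let ?F = "{w \<in> space (PiM ?K (\<lambda>_. ?W)). \<not> ?ok ?K w}"
  let ?H = "\<lambda>(x, s). \<lambda>i\<in>?K. (x i, s i)"
  let ?SS = "signed_sample D m"
  interpret D: prob_space D by fact
  interpret R: prob_space rademacher by (rule prob_space_rademacher)
  interpret W: pair_prob_space D rademacher ..
  obtain b where b: "bij_betw b ?K S"
    using S ex_bij_betw_nat_finite[OF S(1)] by (auto simp: atLeast0LessThan)
  have F: "?F \<in> sets (PiM ?K (\<lambda>_. ?W))"
    by (rule sets_support_failure) (auto intro: measurable_signed_component[OF sets_D])
  have H: "?H \<in> measurable ?SS (PiM ?K (\<lambda>_. ?W))"
    unfolding signed_sample_def case_prod_beta by measurable
  \<comment> \<open>\<open>signed_sample\<close> is a pair of sequences, while the subsample is a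
    sequence of pairs; zipping identifies their laws.\<close>
  have law: "distr ?SS (PiM ?K (\<lambda>_. ?W)) ?H = PiM ?K (\<lambda>_. ?W)"
    using distr_PiM_pair[of ?K D rademacher Pair ?W, OF _ D prob_space_rademacher]
    by (simp add: signed_sample_def id_def)
  have "hull_failure_prob D m \<xi> = measure ?SS (?H -` ?F \<inter> space ?SS)"
    unfolding hull_failure_prob_def
  proof (rule arg_cong[where f="measure ?SS"], intro set_eqI iffI)
    fix \<omega> :: "(nat \<Rightarrow> 'v) \<times> (nat \<Rightarrow> real)"
    have eq: "(*\<^sub>R) \<xi> ` cball 0 1 \<subseteq> convex hull ((\<lambda>i. snd \<omega> i *\<^sub>R fst \<omega> i) ` ?K) \<longleftrightarrow> ?ok ?K (?H \<omega>)"
      using scaled_cball_subset_hull_iff[of ?K \<xi> "\<lambda>i. snd \<omega> i *\<^sub>R fst \<omega> i"] \<open>m > 0\<close> \<open>\<xi> > 0\<close>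
      by (auto simp: case_prod_beta)
    have sp: "?H \<omega> \<in> space (PiM ?K (\<lambda>_. ?W))" if "\<omega> \<in> space ?SS"
      using measurable_space[OF H that] .
    show "\<omega> \<in> ?H -` ?F \<inter> space ?SS"
      if "\<omega> \<in> {\<omega> \<in> space ?SS. \<not> (*\<^sub>R) \<xi> ` cball 0 1 \<subseteq> convex hull ((\<lambda>i. snd \<omega> i *\<^sub>R fst \<omega> i) ` ?K)}"
      using that eq sp by blast
    show "\<omega> \<in> {\<omega> \<in> space ?SS. \<not> (*\<^sub>R) \<xi> ` cball 0 1 \<subseteq> convex hull ((\<lambda>i. snd \<omega> i *\<^sub>R fst \<omega> i) ` ?K)}"
      if "\<omega> \<in> ?H -` ?F \<inter> space ?SS"
      using that eq by blast
  qed
  also have "\<dots> = measure (PiM ?K (\<lambda>_. ?W)) ?F"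
    using measure_distr[OF H F] by (simp add: law)
  also have "\<dots> = measure (PiM I (\<lambda>_. ?W)) {w \<in> space (PiM I (\<lambda>_. ?W)). \<not> ?ok S w}"
  proof -
    \<comment> \<open>Relabelling along the bijection \<open>b\<close> carries the family on
      \<open>I\<close> to a sample indexed by \<open>{..<m}\<close>; the support condition does not
      depend on the labels.\<close>
    let ?R = "\<lambda>\<omega>. \<lambda>k\<in>?K. \<omega> (b k)"
    have bI: "b \<in> ?K \<rightarrow> I" using b S by (auto simp: bij_betw_def)
    have R: "?R \<in> measurable (PiM I (\<lambda>_. ?W)) (PiM ?K (\<lambda>_. ?W))"
      using bI by (intro measurable_restrict measurable_component_singleton) auto
    have "distr (PiM I (\<lambda>_. ?W)) (PiM ?K (\<lambda>_. ?W)) ?R = PiM ?K (\<lambda>_. ?W)"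
      using b bI by (intro distr_PiM_reindex[of I "\<lambda>_. ?W"] W.prob_space_axioms) (auto simp: bij_betw_def)
    then have "measure (PiM ?K (\<lambda>_. ?W)) ?F = measure (PiM I (\<lambda>_. ?W)) (?R -` ?F \<inter> space (PiM I (\<lambda>_. ?W)))"
      using measure_distr[OF R F] by simp
    also have "?R -` ?F \<inter> space (PiM I (\<lambda>_. ?W)) = {w \<in> space (PiM I (\<lambda>_. ?W)). \<not> ?ok S w}"
    proof (intro set_eqI iffI)
      fix w :: "'i \<Rightarrow> 'v \<times> real"
      have "b ` ?K = S" using b by (simp add: bij_betw_def)
      then have eq: "?ok ?K (?R w) \<longleftrightarrow> ?ok S w" by auto
      show "w \<in> {w \<in> space (PiM I (\<lambda>_. ?W)). \<not> ?ok S w}" if "w \<in> ?R -` ?F \<inter> space (PiM I (\<lambda>_. ?W))"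
        using that eq by blast
      show "w \<in> ?R -` ?F \<inter> space (PiM I (\<lambda>_. ?W))" if "w \<in> {w \<in> space (PiM I (\<lambda>_. ?W)). \<not> ?ok S w}"
        using that eq measurable_space[OF R, of w] by blast
    qed
    finally show ?thesis .
  qed
  finally show ?thesis ..
qed

section \<open>How many moduli come close to the maximal noise level\<close>

lemma uniform_hits_lower_tail:
  fixes I :: "'i set" and m :: nat and a L t :: real
  assumes I: "finite I" and "a > 0" "L > 0" "m \<ge> 1" "m \<le> card I"
    and t: "t = a * (L + 1) * m / card I"
  shows "measure (PiM I (\<lambda>_. uniform_measure lborel {0..a}))
      {r \<in> space (PiM I (\<lambda>_. uniform_measure lborel {0..a})). card {i \<in> I. r i \<in> {a - t..}} < m}
    \<le> exp (- L\<^sup>2 / (8 / 3 * L + 2))"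
    (is "measure ?P ?bad \<le> _")
proof -
  let ?V = "uniform_measure lborel {0..a}"
  interpret V: prob_space ?V using \<open>a > 0\<close> by (intro prob_space_uniform_measure) auto
  interpret P: prob_space ?P by (intro prob_space_PiM V.prob_space_axioms)
  have n: "real (card I) > 0" using assms by simp
  show ?thesis
  proof (cases "t \<le> a")
    case True
    have "t > 0" unfolding t using assms n by (intro divide_pos_pos mult_pos_pos) auto
    have "{0..a} \<inter> {a - t..} = {a - t..a}" using True by auto
    then have V: "V.prob {a - t..} = t / a"
      using \<open>a > 0\<close> \<open>t > 0\<close> by simp
    define \<mu> where "\<mu> = (L + 1) * m"
    have \<mu>: "\<mu> = card I * V.prob {a - t..}"
      unfolding V unfolding t \<mu>_def using n \<open>a > 0\<close> by (simp add: field_simps)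
    have m0: "real m > 0" using \<open>m \<ge> 1\<close> by simp
    have "P.prob ?bad \<le> exp (- (\<mu> - m)\<^sup>2 / (2 * \<mu>))"
    proof (rule hits_lower_tail[OF V.prob_space_axioms I _ \<mu>])
      show "real m \<le> \<mu>" "\<mu> > 0" using \<open>L > 0\<close> m0 by (simp_all add: \<mu>_def mult_le_cancel_right1)
    qed simp
    also have "(\<mu> - m)\<^sup>2 / (2 * \<mu>) = m * (L\<^sup>2 / (2 * (L + 1)))"
    proof -
      have "(L * m)\<^sup>2 / (2 * (K * m)) = m * (L\<^sup>2 / (2 * K))" if "K > 0" for K :: real
        using that m0 by (simp add: field_simps power2_eq_square)
      moreover have "\<mu> - m = L * m" by (simp add: \<mu>_def algebra_simps)
      ultimately show ?thesis using \<open>L > 0\<close> unfolding \<mu>_def by simp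
    qed
    then have "- (\<mu> - m)\<^sup>2 / (2 * \<mu>) = - (m * (L\<^sup>2 / (2 * (L + 1))))" by simp
    also have "exp (- (m * (L\<^sup>2 / (2 * (L + 1))))) \<le> exp (- L\<^sup>2 / (8 / 3 * L + 2))"
    proof -
      \<comment> \<open>The Chernoff exponent is the stronger one: 8 L / 3 + 2 \<ge> 2 (L + 1), and
        the factor m is at least 1.\<close>
      have "L\<^sup>2 / (8 / 3 * L + 2) \<le> 1 * (L\<^sup>2 / (2 * (L + 1)))"
        using \<open>L > 0\<close> by (simp add: frac_le)
      also have "\<dots> \<le> m * (L\<^sup>2 / (2 * (L + 1)))"
        using \<open>m \<ge> 1\<close> \<open>L > 0\<close> by (intro mult_right_mono) auto
      finally show ?thesis by simp
    qed
    finally show ?thesis .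
  next
    case False
    have "AE x in ?V. x \<in> {0..a}"
      using \<open>a > 0\<close> by (intro AE_uniform_measureI) auto
    then have "AE r in ?P. \<forall>i\<in>I. r i \<in> {0..a}"
      using I by (intro AE_finite_allI AE_PiM_component V.prob_space_axioms)
    then have "AE r in ?P. r \<notin> ?bad"
    proof (rule eventually_mono)
      fix r assume "\<forall>i\<in>I. r i \<in> {0..a}"
      then have "{i \<in> I. r i \<in> {a - t..}} = I" using False by auto
      then show "r \<notin> ?bad" using \<open>m \<le> card I\<close> by simp
    qed
    then have "P.prob ?bad = 0"
      using sets_hits_less[OF I, of "{a - t..}" ?V m] by (intro measure_eq_0_null_sets AE_iff_null_sets[THEN iffD2]) auto
    then show ?thesis by simp
  qed
qed

section \<open>The deviation bound on the product space of designs and noises\<close>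

lemma sets_deviation:
  fixes g :: "('i \<Rightarrow> 'v::euclidean_space \<times> real) \<Rightarrow> 'v" and I :: "'i set"
  assumes "finite I" and [measurable]: "g \<in> borel_measurable (PiM I (\<lambda>_. borel))"
  shows "{e \<in> space (PiM I (\<lambda>_. borel)). c < norm (g e) \<and>
      (\<forall>i\<in>I. \<bar>fst (e i) \<bullet> g e - snd (e i)\<bar> \<le> a)} \<in> sets (PiM I (\<lambda>_. borel))"
proof -
  have [measurable]: "(\<lambda>e. fst (e i)) \<in> borel_measurable (PiM I (\<lambda>_. borel :: ('v \<times> real) measure))"
      "(\<lambda>e. snd (e i)) \<in> borel_measurable (PiM I (\<lambda>_. borel :: ('v \<times> real) measure))" if "i \<in> I" for i
    unfolding borel_prod[symmetric] using that by measurable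
  show ?thesis
    by (intro sets.sets_Collect_conj sets.sets_Collect_countable_All' countable_finite \<open>finite I\<close>) measurable
qed

text \<open>Here \<open>e i\<close> stands for the design and noise of observation i, and
  \<open>g\<close> for the estimation error as a function of them. The true parameter has
  disappeared: a residual of the estimate is the noise minus the inner product of design and error,
  so feasibility is the second condition of the event. The event is pulled back to the space of
  signed designs and moduli and bounded slice by slice.\<close>

lemma uniform_noise_deviation:
  fixes D :: "'v::euclidean_space measure" and g :: "('i \<Rightarrow> 'v \<times> real) \<Rightarrow> 'v" and I :: "'i set"
    and a \<xi> \<gamma> L :: real and m :: nat
  assumes D: "prob_space D" and sets_D: "sets D = sets borel"
    and I: "finite I" and "a > 0" "\<xi> > 0" "L > 0" and m: "m \<ge> 1" "m \<le> card I"
    and hull: "hull_failure_prob D m \<xi> \<le> \<gamma>"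
    and g[measurable]: "g \<in> borel_measurable (PiM I (\<lambda>_. borel))"
  shows "measure (PiM I (\<lambda>_. D \<Otimes>\<^sub>M uniform_measure lborel {-a..a}))
      {e \<in> space (PiM I (\<lambda>_. borel)). a * (L + 1) * m / (\<xi> * card I) < norm (g e) \<and>
        (\<forall>i\<in>I. \<bar>fst (e i) \<bullet> g e - snd (e i)\<bar> \<le> a)}
    \<le> \<gamma> + exp (- L\<^sup>2 / (8 / 3 * L + 2))"
    (is "measure ?PU ?C \<le> _")
proof -
  let ?W = "D \<Otimes>\<^sub>M rademacher"
  let ?V = "uniform_measure lborel {0..a}"
  let ?PW = "PiM I (\<lambda>_. ?W)"
  let ?PV = "PiM I (\<lambda>_. ?V)"
  let ?h = "\<lambda>w r. (fst w, - snd w * r) :: 'v \<times> real"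
  let ?\<Phi> = "\<lambda>(w, r). \<lambda>i\<in>I. ?h (w i) (r i)"
  interpret D: prob_space D by fact
  interpret R: prob_space rademacher by (rule prob_space_rademacher)
  interpret W: pair_prob_space D rademacher ..
  interpret V: prob_space ?V using \<open>a > 0\<close> by (intro prob_space_uniform_measure) auto
  interpret PW: prob_space ?PW by (intro prob_space_PiM W.prob_space_axioms)
  interpret PV: prob_space ?PV by (intro prob_space_PiM V.prob_space_axioms)
  interpret P: pair_prob_space ?PW ?PV ..
  have C: "?C \<in> sets (PiM I (\<lambda>_. borel))"
    by (rule sets_deviation) fact+
  have h: "(\<lambda>(w, r). ?h w r) \<in> measurable (?W \<Otimes>\<^sub>M ?V) borel"
    using measurable_signed_noise[OF sets_D, of ?V] by simp
  have \<Phi>: "?\<Phi> \<in> measurable (?PW \<Otimes>\<^sub>M ?PV) (PiM I (\<lambda>_. borel))"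
  proof -
    have "(\<lambda>\<omega>. ?h (fst \<omega> i) (snd \<omega> i)) \<in> measurable (?PW \<Otimes>\<^sub>M ?PV) borel" if "i \<in> I" for i
    proof -
      have "(\<lambda>\<omega>. (fst \<omega> i, snd \<omega> i)) \<in> measurable (?PW \<Otimes>\<^sub>M ?PV) (?W \<Otimes>\<^sub>M ?V)" using that by measurable
      from measurable_compose[OF this h] show ?thesis by simp
    qed
    then show ?thesis unfolding case_prod_beta[of _ "_ :: (_ \<times> _)"] by (intro measurable_restrict) auto
  qed
  have law: "distr (?PW \<Otimes>\<^sub>M ?PV) (PiM I (\<lambda>_. borel)) ?\<Phi> = ?PU"
    using distr_PiM_pair[OF I W.prob_space_axioms V.prob_space_axioms h] distr_signed_uniform[OF D sets_D \<open>a > 0\<close>]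
    by simp
  define t where "t = a * (L + 1) * m / card I"
  let ?bad = "{r \<in> space ?PV. card {i \<in> I. r i \<in> {a - t..}} < m}"
  have bad[measurable]: "?bad \<in> sets ?PV" by (intro sets_hits_less I) simp
  let ?E = "?\<Phi> -` ?C \<inter> space (?PW \<Otimes>\<^sub>M ?PV)"
  have E: "?E \<in> sets (?PW \<Otimes>\<^sub>M ?PV)" using \<Phi> C by (rule measurable_sets)
  have \<gamma>: "\<gamma> \<ge> 0" using hull by (rule order_trans[rotated]) (simp add: hull_failure_prob_def)
  \<comment> \<open>The library law of a sign lives on the power set of the reals, so other values are only null.\<close>
  have signs: "AE w in ?PW. \<forall>i\<in>I. \<bar>snd (w i)\<bar> = 1"
  proof -
    have [measurable]: "snd \<in> borel_measurable ?W"
      by (rule measurable_compose[OF _ ident_measurable_rademacher]) measurable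
    have "AE w in ?W. \<bar>snd w\<bar> = 1"
      using AE_rademacher by (subst W.AE_pair_iff[symmetric]) (auto intro: pred_sets2)
    then show ?thesis
      using I by (intro AE_finite_allI AE_PiM_component W.prob_space_axioms)
  qed
  \<comment> \<open>Conditioning on the moduli: bad \<open>r\<close> are bounded trivially by 1,
    good ones by \<gamma>, and the sum of both bounds integrates to the claim.\<close>
  have slice: "emeasure ?PW ((\<lambda>w. (w, r)) -` ?E) \<le> ennreal \<gamma> + indicator ?bad r"
    if r: "r \<in> space ?PV" for r
  proof (cases "r \<in> ?bad")
    case True
    have "emeasure ?PW ((\<lambda>w. (w, r)) -` ?E) \<le> 1" by (rule PW.emeasure_le_1)
    then show ?thesis using True by (simp add: add_increasing)
  next
    case False
    \<comment> \<open>\<open>S\<close> is chosen from \<open>r\<close> alone, so the law of the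
      signed designs on \<open>S\<close> is unaffected. The error \<open>u\<close> does vary with
      \<open>w\<close>, but \<open>?fail\<close> allows any direction, which covers the one picked
      by the estimator.\<close>
    then obtain S where S: "S \<subseteq> {i \<in> I. r i \<in> {a - t..}}" "card S = m" "finite S"
      using r obtain_subset_with_card_n[of m "{i \<in> I. r i \<in> {a - t..}}"] by auto
    let ?fail = "{w \<in> space ?PW. \<not> (\<forall>u. \<exists>i\<in>S. \<xi> * norm u \<le> u \<bullet> (snd (w i) *\<^sub>R fst (w i)))}"
    have SI: "S \<subseteq> I" using S by auto
    have fail: "?fail \<in> sets ?PW"
      by (rule sets_support_failure[OF S(3)]) (use SI in \<open>auto intro!: measurable_signed_component[OF sets_D]\<close>)
    have "AE w in ?PW. w \<in> (\<lambda>w. (w, r)) -` ?E \<longrightarrow> w \<in> ?fail"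
      using signs
    proof (rule eventually_mono, intro impI)
      fix w assume s: "\<forall>i\<in>I. \<bar>snd (w i)\<bar> = 1" and w: "w \<in> (\<lambda>w. (w, r)) -` ?E"
      define u where "u = g (?\<Phi> (w, r))"
      have wsp: "w \<in> space ?PW" using w by (simp add: space_pair_measure split: if_splits)
      have u: "t / \<xi> < norm u"
        using w \<open>\<xi> > 0\<close> unfolding u_def t_def by (simp add: mult.commute)
      have res: "\<bar>fst (w i) \<bullet> u + snd (w i) * r i\<bar> \<le> a" if "i \<in> I" for i
        using w that unfolding u_def by (auto simp: case_prod_beta)
      have "\<not> \<xi> * norm u \<le> u \<bullet> (snd (w i) *\<^sub>R fst (w i))" if "i \<in> S" for i
      proof -
        have i: "i \<in> I" "a - t \<le> r i" using that S by auto
        \<comment> \<open>Multiplying the residual in \<open>res\<close> by a sign of modulus 1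
          keeps its absolute value and gives the inner product with the signed design plus
          \<open>r i\<close>.\<close>
        have "snd (w i) = 1 \<or> snd (w i) = -1" using s i by (auto simp: abs_if split: if_splits)
        then have "u \<bullet> (snd (w i) *\<^sub>R fst (w i)) \<le> a - r i"
          using res[OF i(1)] by (auto simp: inner_commute abs_le_iff)
        also have "\<dots> \<le> t" using i by simp
        also have "\<dots> < \<xi> * norm u" using u \<open>\<xi> > 0\<close> by (simp add: field_simps)
        finally show ?thesis by simp
      qed
      then show "w \<in> ?fail" using wsp by blast
    qed
    then have "emeasure ?PW ((\<lambda>w. (w, r)) -` ?E) \<le> emeasure ?PW ?fail"
      using fail by (intro emeasure_mono_AE) auto
    also have "\<dots> = ennreal (hull_failure_prob D m \<xi>)"
      using hull_failure_prob_subsample[OF D sets_D S(3) SI S(2) _ \<open>\<xi> > 0\<close>] m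
      by (simp add: PW.emeasure_eq_measure)
    also have "\<dots> \<le> ennreal \<gamma>" using hull by (rule ennreal_leI)
    finally show ?thesis by (simp add: add_increasing2)
  qed
  \<comment> \<open>Only the joint law of designs and noises enters, so the event may be computed
    from signs and moduli.\<close>
  have "emeasure ?PU ?C = emeasure (?PW \<Otimes>\<^sub>M ?PV) ?E"
    unfolding law[symmetric] by (rule emeasure_distr[OF \<Phi> C])
  also have "\<dots> = (\<integral>\<^sup>+r. emeasure ?PW ((\<lambda>w. (w, r)) -` ?E) \<partial>?PV)"
    by (rule P.emeasure_pair_measure_alt2[OF E])
  also have "\<dots> \<le> (\<integral>\<^sup>+r. ennreal \<gamma> + indicator ?bad r \<partial>?PV)"
    by (rule nn_integral_mono) (rule slice)
  also have "\<dots> = ennreal \<gamma> + emeasure ?PV ?bad"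
    using bad by (simp add: nn_integral_add PV.emeasure_space_1)
  also have "\<dots> = ennreal (\<gamma> + PV.prob ?bad)"
    using \<gamma> by (simp add: PV.emeasure_eq_measure)
  also have "\<dots> \<le> ennreal (\<gamma> + exp (- L\<^sup>2 / (8 / 3 * L + 2)))"
    using uniform_hits_lower_tail[OF I \<open>a > 0\<close> \<open>L > 0\<close> m t_def] by (intro ennreal_leI) simp
  finally have "emeasure ?PU ?C \<le> ennreal (\<gamma> + exp (- L\<^sup>2 / (8 / 3 * L + 2)))" .
  then show ?thesis
    unfolding measure_def using \<gamma> by (intro enn2real_leI) auto
qed

section \<open>Transfer to the observed data\<close>

theorem theorem2p2:
  fixes M :: "'w measure"
    and X :: "nat \<Rightarrow> 'w \<Rightarrow> real ^ 'p"
    and Y \<epsilon> :: "nat \<Rightarrow> 'w \<Rightarrow> real"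
    and \<beta> :: "real ^ 'p"
    and D :: "(real ^ 'p) measure"
    and f :: "nat \<Rightarrow> real \<Rightarrow> real"
    and est :: "(nat \<Rightarrow> (real ^ 'p) \<times> real) \<Rightarrow> real ^ 'p"
    and a \<gamma> \<xi> L :: real
    and n :: nat
  assumes "prob_space M"
    and "n \<ge> 1" and "a > 0" and "\<gamma> > 0" and "\<xi> > 0" and "L > 0"
    and iid: "iid_vars M borel (\<lambda>i \<omega>. (X i \<omega>, Y i \<omega>)) {..<n}"
    and model: "\<And>i \<omega>. i < n \<Longrightarrow> \<omega> \<in> space M \<Longrightarrow> Y i \<omega> = X i \<omega> \<bullet> \<beta> + \<epsilon> i \<omega>"
    and noise: "\<And>i. i < n \<Longrightarrow> distr M borel (\<epsilon> i) = uniform_measure lborel {-a..a}"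
    and indep: "\<And>i. i < n \<Longrightarrow> indep_pair M borel (X i) borel (\<epsilon> i)"
    and design: "\<And>i. i < n \<Longrightarrow> distr M borel (X i) = D"
    and hull: "\<And>m. real m \<ge> f CARD('p) \<gamma> \<Longrightarrow> hull_failure_prob D m \<xi> \<le> \<gamma>"
    and sample_size: "real n \<ge> f CARD('p) \<gamma>"
    and est_measurable: "est \<in> borel_measurable (\<Pi>\<^sub>M i\<in>{..<n}. borel)"
    and est_feasible: "AE \<omega> in M. est (sample_data n X Y \<omega>) \<in> feasible_set a n (sample_data n X Y \<omega>)"
  shows "measure M {\<omega> \<in> space M.
            norm (est (sample_data n X Y \<omega>) - \<beta>)
              \<le> a * (L + 1) * of_int \<lceil>f CARD('p) \<gamma>\<rceil> / (\<xi> * real n)}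
         \<ge> 1 - \<gamma> - exp (- L\<^sup>2 / (8 / 3 * L + 2))"
proof -
  interpret prob_space M by fact
  let ?I = "{..<n}"
  let ?U = "uniform_measure lborel {-a..a}"
  have X: "X i \<in> borel_measurable M" if "i < n" for i
    using indep[OF that] by (auto simp: indep_pair_def)
  have D: "prob_space D" and sets_D: "sets D = sets borel"
    using design[of 0] \<open>n \<ge> 1\<close> prob_space_distr[OF X[of 0]] by auto
  show ?thesis
  proof (cases "\<lceil>f CARD('p) \<gamma>\<rceil> \<le> 0")
    case True
    \<comment> \<open>The hull of the empty sample is empty, so \<open>m = 0\<close> is admissible only if \<open>\<gamma> \<ge> 1\<close>.\<close>
    then have "f CARD('p) \<gamma> \<le> real 0" by simp
    then have "hull_failure_prob D 0 \<xi> \<le> \<gamma>" by (rule hull)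
    moreover have "hull_failure_prob D 0 \<xi> = 1"
    proof -
      interpret S: prob_space "signed_sample D 0"
        unfolding signed_sample_def
        by (intro prob_space_pair prob_space_PiM D prob_space_rademacher)
      show ?thesis by (simp add: hull_failure_prob_def S.prob_space)
    qed
    ultimately have "1 - \<gamma> - exp (- L\<^sup>2 / (8 / 3 * L + 2)) \<le> 0"
      using exp_gt_zero[of "- L\<^sup>2 / (8 / 3 * L + 2)"] by linarith
    then show ?thesis by (rule order_trans) simp
  next
    case False
    define m where "m = nat \<lceil>f CARD('p) \<gamma>\<rceil>"
    have m_int: "of_int \<lceil>f CARD('p) \<gamma>\<rceil> = real m" using False by (simp add: m_def)
    have m: "m \<ge> 1" "m \<le> n" and "real m \<ge> f CARD('p) \<gamma>"
      using False sample_size by (auto simp: m_def nat_le_iff ceiling_le_iff le_nat_iff)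
    then have hull_m: "hull_failure_prob D m \<xi> \<le> \<gamma>" by (intro hull) simp
    define bound where "bound = a * (L + 1) * real m / (\<xi> * card ?I)"
    let ?P = "PiM ?I (\<lambda>_. borel :: ((real ^ 'p) \<times> real) measure)"
    \<comment> \<open>\<open>?T\<close> rebuilds the data from designs and noises, and
      \<open>?e\<close> recovers design and noise from the data. Using Y - X \<bullet> \<beta> in
      place of \<epsilon> makes \<open>?e i\<close> a Borel function of the i-th observation, so
      independence across observations carries over.\<close>
    let ?T = "\<lambda>e. \<lambda>i\<in>?I. (fst (e i), fst (e i) \<bullet> \<beta> + snd (e i))"
    let ?e = "\<lambda>i \<omega>. (X i \<omega>, Y i \<omega> - X i \<omega> \<bullet> \<beta>)"
    let ?E = "\<lambda>\<omega>. \<lambda>i\<in>?I. ?e i \<omega>"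
    define g where "g = (\<lambda>e. est (?T e) - \<beta>)"
    have T: "?T \<in> measurable ?P ?P"
    proof (rule measurable_restrict)
      fix i assume "i \<in> ?I"
      then have "(\<lambda>e. e i) \<in> measurable ?P borel" by (rule measurable_component_singleton)
      then show "(\<lambda>e. (fst (e i), fst (e i) \<bullet> \<beta> + snd (e i))) \<in> measurable ?P borel"
        by (rule measurable_compose) (intro borel_measurable_continuous_onI continuous_intros)
    qed
    have g: "g \<in> borel_measurable ?P"
      unfolding g_def by (intro borel_measurable_diff measurable_compose[OF T est_measurable]) simp
    have g_E: "g (?E \<omega>) = est (sample_data n X Y \<omega>) - \<beta>" for \<omega>
    proof -
      have "?T (?E \<omega>) = sample_data n X Y \<omega>"
        unfolding sample_data_def by (rule restrict_ext) simp
      then show ?thesis unfolding g_def by simp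
    qed
    have e: "?e i \<in> borel_measurable M" if "i < n" for i
    proof -
      have "(\<lambda>\<omega>. (X i \<omega>, Y i \<omega>)) \<in> borel_measurable M"
        using iid that by (auto simp: iid_vars_def indep_vars_def)
      then have "(\<lambda>\<omega>. (fst (X i \<omega>, Y i \<omega>), snd (X i \<omega>, Y i \<omega>) - fst (X i \<omega>, Y i \<omega>) \<bullet> \<beta>)) \<in> borel_measurable M"
        by (rule measurable_compose) (intro borel_measurable_continuous_onI continuous_intros)
      then show ?thesis by simp
    qed
    have "indep_vars (\<lambda>_. borel) (\<lambda>i \<omega>. (\<lambda>z. (fst z, snd z - fst z \<bullet> \<beta>)) (X i \<omega>, Y i \<omega>)) ?I"
      using iid unfolding iid_vars_def
      by (elim conjE indep_vars_compose2[where Y="\<lambda>_ z. (fst z, snd z - fst z \<bullet> \<beta>)"])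
        (intro borel_measurable_continuous_onI continuous_intros)
    then have "indep_vars (\<lambda>_. borel) ?e ?I" by simp
    then have "distr M ?P ?E = PiM ?I (\<lambda>i. distr M borel (?e i))"
      using \<open>n \<ge> 1\<close> e by (subst (asm) indep_vars_iff_distr_eq_PiM') (auto simp: lessThan_empty_iff)
    \<comment> \<open>The two kinds of independence are combined: across observations from
      \<open>iid\<close>, and between design and noise within one observation from
      \<open>indep\<close>.\<close>
    also have "\<dots> = PiM ?I (\<lambda>_. D \<Otimes>\<^sub>M ?U)"
    proof (rule PiM_cong[OF refl])
      fix i assume "i \<in> ?I"
      then have i: "i < n" by simp
      have "distr M borel (?e i) = distr M (borel \<Otimes>\<^sub>M borel) (\<lambda>\<omega>. (X i \<omega>, \<epsilon> i \<omega>))"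
        using model[OF i] by (intro distr_cong arg_cong[OF borel_prod[symmetric]]) auto
      also have "\<dots> = D \<Otimes>\<^sub>M ?U"
        using distr_pair_of_indep_pair[OF \<open>prob_space M\<close> indep[OF i]] by (simp add: design[OF i] noise[OF i])
      finally show "distr M borel (?e i) = D \<Otimes>\<^sub>M ?U" .
    qed
    finally have law: "distr M ?P ?E = PiM ?I (\<lambda>_. D \<Otimes>\<^sub>M ?U)" .
    have E: "?E \<in> measurable M ?P" using e by (intro measurable_restrict) simp
    let ?C = "{e \<in> space ?P. bound < norm (g e) \<and> (\<forall>i\<in>?I. \<bar>fst (e i) \<bullet> g e - snd (e i)\<bar> \<le> a)}"
    have C: "?C \<in> sets ?P" by (rule sets_deviation[OF _ g]) simp
    let ?G = "{\<omega> \<in> space M. norm (g (?E \<omega>)) \<le> bound}"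
    have G: "?G \<in> sets M"
      using measurable_compose[OF E g] by measurable
    \<comment> \<open>Feasibility of the estimate holds only almost surely, hence an inclusion up to
      a null set.\<close>
    have "AE \<omega> in M. \<omega> \<in> space M - ?G \<longrightarrow> \<omega> \<in> ?E -` ?C \<inter> space M"
      using est_feasible
    proof (rule eventually_mono, intro impI)
      fix \<omega>
      assume feas: "est (sample_data n X Y \<omega>) \<in> feasible_set a n (sample_data n X Y \<omega>)"
        and \<omega>: "\<omega> \<in> space M - ?G"
      have "\<bar>fst (?E \<omega> i) \<bullet> g (?E \<omega>) - snd (?E \<omega> i)\<bar> \<le> a" if "i \<in> ?I" for i
        using feas that unfolding g_E feasible_set_def
        by (auto simp: sample_data_def inner_diff_right abs_le_iff)
      then show "\<omega> \<in> ?E -` ?C \<inter> space M"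
        using \<omega> measurable_space[OF E] by auto
    qed
    then have "prob (space M - ?G) \<le> prob (?E -` ?C \<inter> space M)"
      using measurable_sets[OF E C] by (intro finite_measure_mono_AE)
    also have "\<dots> = measure (PiM ?I (\<lambda>_. D \<Otimes>\<^sub>M ?U)) ?C"
      using measure_distr[OF E C] by (simp add: law)
    also have "\<dots> \<le> \<gamma> + exp (- L\<^sup>2 / (8 / 3 * L + 2))"
      using uniform_noise_deviation[OF D sets_D _ \<open>a > 0\<close> \<open>\<xi> > 0\<close> \<open>L > 0\<close> m(1) _ hull_m g] m(2)
      by (simp add: bound_def)
    finally have "1 - \<gamma> - exp (- L\<^sup>2 / (8 / 3 * L + 2)) \<le> prob ?G"
      using G by (simp add: prob_compl)
    then show ?thesis by (simp add: g_E bound_def m_int)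
  qed
qed

end
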